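(* Let $u\colon\mathbb{R}^3\to\mathbb{O}$ be such that its octonion Fourier transform $U_{\mathrm{OFT}}$ takes values in $\mathbb{C}_{\mathbf{e}_4}$. Let $\hat u$ be the classical inverse Fourier transform of $U_{\mathrm{OFT}}$ in the complex subfield $\mathbb{C}_{\mathbf{e}_4}$ of $\mathbb{O}$, i.e. $$\hat u(x_1,x_2,x_3)=\int_{\mathbb{R}^3}U_{\mathrm{OFT}}(\mathbf{f})\,e^{\mathbf{e}_4 2\pi f_1x_1}e^{\mathbf{e}_4 2\pi f_2x_2}e^{\mathbf{e}_4 2\pi f_3x_3}\,d\mathbf{f}.$$ Then for all $(x_1,x_2,x_3)\in\mathbb{R}^3$ $$\begin{aligned}u(x_1,x_2,x_3)&=\tfrac14\big(\hat u(x_1,x_2,x_3)\cdot(1+\mathbf{e}_6)+\hat u(x_1,-x_2,x_3)\cdot(1-\mathbf{e}_6)\big)\cdot(1+\mathbf{e}_5)\\&\quad+\tfrac14\big(\hat u(-x_1,x_2,x_3)\cdot(1+\mathbf{e}_6)+\hat u(-x_1,-x_2,x_3)\cdot(1-\mathbf{e}_6)\big)\cdot(1-\mathbf{e}_5),\end{aligned}$$ where octonion multiplication is done from left to right.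
   Context: $\mathbb{O}$ denotes the real algebra of octonions with basis $1,\mathbf{e}_1,\dots,\mathbf{e}_7$: an octonion is a pair $(q_0,q_1)$ of quaternions (quaternion units $\mathbf{e}_1,\mathbf{e}_2,\mathbf{e}_3$ with $\mathbf{e}_1\mathbf{e}_2=\mathbf{e}_3$), with product $(q_0,q_1)\cdot(p_0,p_1)=(q_0p_0-p_1^*q_1,\;p_1q_0+q_1p_0^* )$, where $^*$ is quaternion conjugation, and $\mathbf{e}_4=(0,1)$, $\mathbf{e}_5=(0,\mathbf{e}_1)$, $\mathbf{e}_6=(0,\mathbf{e}_2)$, $\mathbf{e}_7=(0,\mathbf{e}_3)$. The product is neither commutative nor associative; products without brackets are evaluated from left to right, i.e. $abcd=((ab)c)d$. For an imaginary unit $\mathbf{e}_k$ and $\alpha\in\mathbb{R}$, $e^{\mathbf{e}_k\alpha}=\cos\alpha+\mathbf{e}_k\sin\alpha$. Integrals of octonion-valued functions are taken componentwise. The octonion Fourier transform (OFT) of a Lebesgue integrable $u\colon\mathbb{R}^3\to\mathbb{O}$ is $$U_{\mathrm{OFT}}(\mathbf{f})=\int_{\mathbb{R}^3}u(\mathbf{x})\,e^{-\mathbf{e}_1 2\pi f_1x_1}\,e^{-\mathbf{e}_2 2\pi f_2x_2}\,e^{-\mathbf{e}_4 2\pi f_3x_3}\,d\mathbf{x},\qquad \mathbf{f}=(f_1,f_2,f_3)\in\mathbb{R}^3,$$ with multiplication from left to right. $\mathbb{C}_{\mathbf{e}_4}=\{a+b\mathbf{e}_4: a,b\in\mathbb{R}\}\subset\mathbb{O}$.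 Standing assumption: $u$ has a well-defined, invertible OFT, namely $u$ is continuous and both $u$ and $U_{\mathrm{OFT}}$ are Lebesgue integrable, so that $u(\mathbf{x})=\int_{\mathbb{R}^3}U_{\mathrm{OFT}}(\mathbf{f})\,e^{\mathbf{e}_4 2\pi f_3x_3}e^{\mathbf{e}_2 2\pi f_2x_2}e^{\mathbf{e}_1 2\pi f_1x_1}\,d\mathbf{f}$ (left to right). *)

theory Defs
  imports "HOL-Analysis.Analysis"
begin

text \<open>
  Quaternions and octonions are represented as nested products of \<open>real\<close>, so that addition,
  scaling and topology are componentwise, and the Bochner integral of an octonion-valued
  function is the componentwise integral.  A quaternion \<open>(a, b, c, d)\<close> stands for
  \<open>a + b e1 + c e2 + d e3\<close>.
\<close>

type_synonym quaternion = "real \<times> real \<times> real \<times> real"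
type_synonym octonion = "quaternion \<times> quaternion"

fun qmult :: "quaternion \<Rightarrow> quaternion \<Rightarrow> quaternion" where
  "qmult (a, b, c, d) (a', b', c', d') =
     (a * a' - b * b' - c * c' - d * d',
      a * b' + b * a' + c * d' - d * c',
      a * c' - b * d' + c * a' + d * b',
      a * d' + b * c' - c * b' + d * a')"

fun qcnj :: "quaternion \<Rightarrow> quaternion" where
  "qcnj (a, b, c, d) = (a, - b, - c, - d)"

fun omult :: "octonion \<Rightarrow> octonion \<Rightarrow> octonion" (infixl "\<cdot>" 70) where
  "(q0, q1) \<cdot> (p0, p1) =
     (qmult q0 p0 - qmult (qcnj p1) q1, qmult p1 q0 + qmult q1 (qcnj p0))"

text \<open>\<open>oe 0\<close> is the unit \<open>1\<close> and \<open>oe k\<close> the imaginary unit \<open>e_k\<close> for \<open>1 \<le> k \<le> 7\<close>;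
  for \<open>k > 7\<close> it is the junk value \<open>0\<close>.\<close>

definition oe :: "nat \<Rightarrow> octonion" where
  "oe k = ((of_bool (k = 0), of_bool (k = 1), of_bool (k = 2), of_bool (k = 3)),
           (of_bool (k = 4), of_bool (k = 5), of_bool (k = 6), of_bool (k = 7)))"

lemma oe_0_unit: "oe 0 \<cdot> p = p" "p \<cdot> oe 0 = p"
  by (cases p; cases "fst p"; cases "snd p"; auto simp: oe_def zero_prod_def)+

lemma oe_table: "oe 1 \<cdot> oe 2 = oe 3" "oe 1 \<cdot> oe 4 = oe 5" "oe 2 \<cdot> oe 4 = oe 6" "oe 3 \<cdot> oe 4 = oe 7"
  by (simp_all add: oe_def zero_prod_def)

text \<open>The exponential of \<open>\<alpha> e_k\<close>; meaningful for \<open>1 \<le> k \<le> 7\<close>.\<close>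

definition oexp :: "nat \<Rightarrow> real \<Rightarrow> octonion" where
  "oexp k \<alpha> = cos \<alpha> *\<^sub>R oe 0 + sin \<alpha> *\<^sub>R oe k"

definition C_e4 :: "octonion set" where
  "C_e4 = {a *\<^sub>R oe 0 + b *\<^sub>R oe 4 | a b. True}"

definition OFT :: "(real ^ 3 \<Rightarrow> octonion) \<Rightarrow> real ^ 3 \<Rightarrow> octonion" where
  "OFT u f = (LINT x|lebesgue.
     u x \<cdot> oexp 1 (- (2 * pi * f $ 1 * x $ 1))
         \<cdot> oexp 2 (- (2 * pi * f $ 2 * x $ 2))
         \<cdot> oexp 4 (- (2 * pi * f $ 3 * x $ 3)))"

definition inverse_FT_e4 :: "(real ^ 3 \<Rightarrow> octonion) \<Rightarrow> real ^ 3 \<Rightarrow> octonion" where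
  "inverse_FT_e4 U x = (LINT f|lebesgue.
     U f \<cdot> oexp 4 (2 * pi * f $ 1 * x $ 1)
         \<cdot> oexp 4 (2 * pi * f $ 2 * x $ 2)
         \<cdot> oexp 4 (2 * pi * f $ 3 * x $ 3))"

end

theory Submission
  imports Defs "HOL-Probability.Characteristic_Functions" "HOL-Real_Asymp.Real_Asymp"
begin

text \<open>
  The theorem is the octonion Fourier inversion formula followed by a pointwise identity.  Inversion
  writes \<open>u y\<close> as the integral over \<open>f\<close> of \<open>OFT u f \<cdot> e^{e4 \<gamma>} \<cdot> e^{e2 \<beta>} \<cdot> e^{e1 \<alpha>}\<close>, where \<open>\<alpha>\<close>, \<open>\<beta>\<close>,
  \<open>\<gamma>\<close> are the phases \<open>2 \<pi> f_i y_i\<close>.  If \<open>c = OFT u f\<close> lies in the span of \<open>1\<close> and \<open>e4\<close>, this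
  integrand is a combination of the four products \<open>c e^{e4 (\<plusminus>\<alpha> \<plusminus>\<beta> + \<gamma>)}\<close> multiplied on the right by
  \<open>1 \<plusminus> e6\<close> and then \<open>1 \<plusminus> e5\<close> (\<open>e4_valued_synthesis\<close>): since \<open>e4 e6 = e2\<close> and \<open>e4 e5 = e1\<close>, the odd part
  in \<open>\<beta>\<close> turns \<open>e4 sin \<beta>\<close> into \<open>e2 sin \<beta>\<close>, and the odd part in \<open>\<alpha>\<close> turns \<open>e4 sin \<alpha>\<close> into
  \<open>e1 sin \<alpha>\<close>.  Right multiplication is linear and commutes with the integral, so the four products
  integrate to the four values of the \<open>e4\<close>-transform.

  Inversion is proved by Gaussian regularisation.  Weight the inverse integral by a Gaussian
  \<open>W_s(f)\<close>, insert the definition of the OFT and exchange the integrals.  Neither the noncommuting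
  exponentials nor the missing associativity obstructs the evaluation of the inner integral over
  \<open>f\<close>: the exponentials of \<open>e4\<close> meet in the middle of the product and combine, by alternativity, to one
  exponential with phase \<open>\<theta> = 2 \<pi> f_3 (y_3 - x_3)\<close>; averaging over the reflection \<open>f_3 \<mapsto> - f_3\<close>, which
  fixes everything else, replaces it by the scalar \<open>cos \<theta>\<close>.  Now the exponentials of \<open>e2\<close> are
  adjacent, then those of \<open>e1\<close>, and the kernel collapses to the scalar cosine transform of a Gaussian
  (\<open>integral_regularised_kernel\<close>).  The regularised integral is therefore the convolution of \<open>u\<close> with
  a narrow normal density, which tends to \<open>u y\<close> at every point of continuity
  (\<open>gauss_kernel_approximate_identity\<close>), while by dominated convergence it tends to the integral without
  weight.
\<close>

section \<open>Gaussians on Euclidean space\<close>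

text \<open>Lebesgue measure is the image of a product measure, so functions that separate in the coordinates
  integrate factor by factor.\<close>

lemma
  fixes h :: "'a::euclidean_space \<Rightarrow> real \<Rightarrow> real"
  assumes h: "\<And>b. b \<in> Basis \<Longrightarrow> integrable lborel (h b)"
  shows integrable_lborel_prod: "integrable lborel (\<lambda>x. \<Prod>b\<in>Basis. h b (x \<bullet> b))"
    and integral_lborel_prod: "(LBINT x. (\<Prod>b\<in>Basis. h b (x \<bullet> b))) = (\<Prod>b\<in>Basis. LBINT t. h b t)"
proof -
  interpret product_sigma_finite "\<lambda>_::'a. lborel :: real measure" ..
  let ?T = "\<lambda>f::'a \<Rightarrow> real. \<Sum>b\<in>Basis. f b *\<^sub>R b"
  have [measurable]: "h b \<in> borel_measurable borel" if "b \<in> Basis" for b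
    using borel_measurable_integrable[OF h[OF that]] by simp
  have T: "?T \<in> (\<Pi>\<^sub>M b\<in>Basis. lborel) \<rightarrow>\<^sub>M borel" by measurable
  have m: "(\<lambda>x. \<Prod>b\<in>Basis. h b (x \<bullet> b)) \<in> borel_measurable borel" by measurable
  have coord: "(\<Prod>b\<in>Basis. h b (?T f \<bullet> b)) = (\<Prod>b\<in>Basis. h b (f b))" for f :: "'a \<Rightarrow> real"
    by (intro prod.cong) simp_all
  show "integrable lborel (\<lambda>x. \<Prod>b\<in>Basis. h b (x \<bullet> b))"
    unfolding lborel_eq[where 'a='a] integrable_distr_eq[OF T m] coord
    using h by (intro product_integrable_prod) auto
  show "(LBINT x. (\<Prod>b\<in>Basis. h b (x \<bullet> b))) = (\<Prod>b\<in>Basis. LBINT t. h b t)"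
    unfolding lborel_eq[where 'a='a] integral_distr[OF T m] coord
    using h by (intro product_integral_prod) auto
qed

text \<open>The real part of the characteristic function of the standard normal distribution.\<close>

lemma std_normal_cosine_transform:
  "(LBINT x. std_normal_density x * cos (t * x)) = exp (- t\<^sup>2 / 2)"
proof -
  interpret N: prob_space std_normal_distribution
    by (intro prob_space_normal_density) simp
  have int: "integrable std_normal_distribution (\<lambda>x. iexp (t * x))"
    by (intro N.integrable_const_bound[where B=1]) auto
  have "exp (- t\<^sup>2 / 2) = Re (CLINT x|std_normal_distribution. iexp (t * x))"
    using fun_cong[OF char_std_normal_distribution, of t] by (simp add: char_def)
  also have "\<dots> = (LINT x|std_normal_distribution. cos (t * x))"
    by (subst integral_Re[OF int, symmetric]) (simp add: Re_exp)
  also have "\<dots> = (LBINT x. std_normal_density x * cos (t * x))"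
    by (subst integral_density) auto
  finally show ?thesis by simp
qed

lemma
  fixes s z :: real
  assumes "s > 0"
  shows integrable_gaussian_cos:
      "integrable lborel (\<lambda>t. exp (- (2 * pi * s * t)\<^sup>2 / 2) * cos (2 * pi * t * z))"
    and integral_gaussian_cos:
      "(LBINT t. exp (- (2 * pi * s * t)\<^sup>2 / 2) * cos (2 * pi * t * z)) = normal_density 0 s z"
proof -
  let ?c = "2 * pi * s"
  let ?g = "\<lambda>x. std_normal_density x * cos (z / s * x)"
  have c: "?c \<noteq> 0" using assms by simp
  have g: "exp (- (?c * t)\<^sup>2 / 2) * cos (2 * pi * t * z) = sqrt (2 * pi) * ?g (0 + ?c * t)" for t
    using assms by (simp add: std_normal_density_def field_simps)
  have "integrable lborel ?g"
    by (rule Bochner_Integration.integrable_bound[OF integrable_normal_density[of 1 0]])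
       (auto simp: abs_mult mult_left_le)
  from lborel_integrable_real_affine[OF this c, of 0]
  show "integrable lborel (\<lambda>t. exp (- (?c * t)\<^sup>2 / 2) * cos (2 * pi * t * z))"
    unfolding g by simp
  have "?c * (LBINT t. ?g (0 + ?c * t)) = exp (- (z / s)\<^sup>2 / 2)"
    using lborel_integral_real_affine[OF c, of ?g 0] assms
    by (simp only: std_normal_cosine_transform) simp
  then have I: "(LBINT t. ?g (0 + ?c * t)) = exp (- (z / s)\<^sup>2 / 2) / ?c"
    using c by (simp add: field_simps)
  have "(LBINT t. exp (- (?c * t)\<^sup>2 / 2) * cos (2 * pi * t * z))
      = sqrt (2 * pi) * (exp (- (z / s)\<^sup>2 / 2) / ?c)"
    unfolding g by (simp only: integral_mult_right_zero I)
  also have "\<dots> = normal_density 0 s z"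
    using assms by (simp add: normal_density_def real_sqrt_mult power_divide field_simps)
  finally show "(LBINT t. exp (- (?c * t)\<^sup>2 / 2) * cos (2 * pi * t * z)) = normal_density 0 s z" .
qed

text \<open>The weight \<open>gauss_weight s\<close> lives on the frequency side; the scale is chosen so that its cosine
  transform is the centred normal density \<open>gauss_kernel s\<close> with standard deviation \<open>s\<close> in every
  coordinate.  As \<open>s\<close> tends to \<open>0\<close> the weight tends to \<open>1\<close> and the kernel concentrates at \<open>0\<close>.\<close>

definition gauss_weight :: "real \<Rightarrow> 'a::euclidean_space \<Rightarrow> real" where
  "gauss_weight s f = exp (- (2 * pi * s * norm f)\<^sup>2 / 2)"

definition gauss_kernel :: "real \<Rightarrow> 'a::euclidean_space \<Rightarrow> real" where
  "gauss_kernel s z = (\<Prod>b\<in>Basis. normal_density 0 s (z \<bullet> b))"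

lemma gauss_weight_prod:
  "gauss_weight s (f::'a::euclidean_space) = (\<Prod>b\<in>Basis. exp (- (2 * pi * s * (f \<bullet> b))\<^sup>2 / 2))"
proof -
  have "(norm f)\<^sup>2 = (\<Sum>b\<in>Basis. (f \<bullet> b)\<^sup>2)"
    unfolding power2_norm_eq_inner by (subst euclidean_inner) (simp add: power2_eq_square)
  then show ?thesis
    by (simp add: gauss_weight_def exp_sum[symmetric] power_mult_distrib sum_distrib_left
        sum_divide_distrib sum_negf)
qed

lemma gauss_kernel_norm:
  assumes "s > 0"
  shows "gauss_kernel s (z::'a::euclidean_space)
       = (1 / (sqrt (2 * pi) * s)) ^ DIM('a) * exp (- (norm z)\<^sup>2 / (2 * s\<^sup>2))"
proof -
  have "(norm z)\<^sup>2 = (\<Sum>b\<in>Basis. (z \<bullet> b)\<^sup>2)"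
    unfolding power2_norm_eq_inner by (subst euclidean_inner) (simp add: power2_eq_square)
  moreover have "sqrt (2 * pi * s\<^sup>2) = sqrt (2 * pi) * s"
    using assms by (simp add: real_sqrt_mult)
  ultimately show ?thesis
    by (simp add: gauss_kernel_def normal_density_def prod.distrib exp_sum[symmetric]
        sum_divide_distrib sum_negf prod_dividef power_divide)
qed

lemma gauss_kernel_measurable [measurable]: "gauss_kernel s \<in> borel_measurable borel"
  unfolding gauss_kernel_def[abs_def] by measurable

lemma continuous_gauss_weight: "continuous_on A g \<Longrightarrow> continuous_on A (\<lambda>x. gauss_weight s (g x))"
  unfolding gauss_weight_def by (intro continuous_intros) auto

lemma
  assumes "s > 0"
  shows integrable_gauss_weight_cos: "integrable lborel
      (\<lambda>f::'a::euclidean_space. gauss_weight s f * (\<Prod>b\<in>Basis. cos (2 * pi * (f \<bullet> b) * (z \<bullet> b))))"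
    and integral_gauss_weight_cos: "(LBINT f. gauss_weight s f *
      (\<Prod>b\<in>Basis. cos (2 * pi * (f \<bullet> b) * (z \<bullet> b)))) = gauss_kernel s (z::'a::euclidean_space)"
  unfolding gauss_weight_prod prod.distrib[symmetric] gauss_kernel_def
  by (rule integrable_lborel_prod, rule integrable_gaussian_cos[OF assms])
     (simp only: integral_lborel_prod[where h="\<lambda>b t. exp (- (2 * pi * s * t)\<^sup>2 / 2) * cos (2 * pi * t * (z \<bullet> b))",
        OF integrable_gaussian_cos[OF assms]] integral_gaussian_cos[OF assms])

lemma integrable_gauss_weight:
  "s > 0 \<Longrightarrow> integrable lborel (gauss_weight s :: 'a::euclidean_space \<Rightarrow> real)"
  using integrable_gauss_weight_cos[where z="0::'a"] by simp

lemma integrable_gauss_kernel: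
  assumes "s > 0"
  shows "integrable lborel (gauss_kernel s :: 'a::euclidean_space \<Rightarrow> real)"
    and "integral\<^sup>L lborel (gauss_kernel s :: 'a::euclidean_space \<Rightarrow> real) = 1"
proof -
  have I: "integrable lborel (normal_density 0 s)" using assms by simp
  show "integrable lborel (gauss_kernel s :: 'a \<Rightarrow> real)"
    unfolding gauss_kernel_def[abs_def] by (rule integrable_lborel_prod, rule I)
  show "integral\<^sup>L lborel (gauss_kernel s :: 'a \<Rightarrow> real) = 1"
    unfolding gauss_kernel_def[abs_def] integral_lborel_prod[where h="\<lambda>_. normal_density 0 s", OF I]
    using assms by simp
qed

section \<open>Approximate identity and reflections\<close>

lemma integral_affine_reparam:
  fixes F :: "'a::euclidean_space \<Rightarrow> 'b::{banach,second_countable_topology}"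
  assumes "c \<noteq> 0" and [measurable]: "F \<in> borel_measurable borel"
  shows "integral\<^sup>L lborel F = (LBINT x. (\<bar>c\<bar> ^ DIM('a)) *\<^sub>R F (t + c *\<^sub>R x))"
  by (subst lborel_affine[OF assms(1), of t])
     (simp add: integral_density integral_distr)

text \<open>An integrable \<open>u\<close> may be unbounded, so it is cut at a ball around \<open>y\<close> on which continuity bounds
  it.  Inside, rescaling the variable gives a fixed Gaussian and dominated convergence applies;
  outside, the kernel is uniformly small and the integrability of \<open>u\<close> suffices.\<close>

lemma gauss_kernel_approximate_identity:
  fixes u :: "'a::euclidean_space \<Rightarrow> 'b::{banach,second_countable_topology}"
  assumes u: "integrable lborel u" and cont: "isCont u y"
    and s0: "s \<longlonglongrightarrow> 0" and s_pos: "\<And>n. s n > 0"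
  shows "(\<lambda>n. LBINT x. gauss_kernel (s n) (y - x) *\<^sub>R u x) \<longlonglongrightarrow> u y"
proof -
  have um[measurable]: "u \<in> borel_measurable borel" using u by auto
  from cont obtain d where d: "d > 0" "\<And>x. dist x y < d \<Longrightarrow> dist (u x) (u y) < 1"
    unfolding continuous_at_eps_delta by (metis zero_less_one)
  define near where "near x = indicator (ball y d) x *\<^sub>R u x" for x
  define far where "far x = indicator (- ball y d) x *\<^sub>R u x" for x
  have [measurable]: "near \<in> borel_measurable borel" "far \<in> borel_measurable borel"
    unfolding near_def[abs_def] far_def[abs_def]
    by (intro borel_measurable_scaleR borel_measurable_indicator um; simp)+
  have near_bound: "norm (near x) \<le> norm (u y) + 1" for x
  proof (cases "x \<in> ball y d")
    case True
    then have "norm (u x - u y) < 1" using d(2)[of x] by (simp add: dist_commute dist_norm)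
    then show ?thesis using True norm_triangle_sub[of "u x" "u y"] by (simp add: near_def)
  qed (auto simp: near_def)
  have near_cont: "isCont near y"
  proof -
    have "\<forall>\<^sub>F x in nhds y. near x = u x"
      using d(1) by (intro eventually_nhds_in_open[of "ball y d", THEN eventually_mono])
        (auto simp: near_def)
    then show ?thesis using cont isCont_cong by blast
  qed
  have ker: "integrable lborel (\<lambda>x. gauss_kernel (s n) (y - x) *\<^sub>R w x)"
    if w: "integrable lborel w" and [measurable]: "w \<in> borel_measurable borel"
    for n and w :: "'a \<Rightarrow> 'b"
  proof (rule Bochner_Integration.integrable_bound)
    show "integrable lborel (\<lambda>x. (1 / (sqrt (2 * pi) * s n)) ^ DIM('a) *\<^sub>R w x)" using w by simp
    show "AE x in lborel. norm (gauss_kernel (s n) (y - x) *\<^sub>R w x)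
        \<le> norm ((1 / (sqrt (2 * pi) * s n)) ^ DIM('a) *\<^sub>R w x)"
      using s_pos[of n] by (auto simp: gauss_kernel_norm abs_mult intro!: mult_left_le_one_le)
  qed measurable
  have near_int: "integrable lborel near" and far_int: "integrable lborel far"
    unfolding near_def[abs_def] far_def[abs_def]
    using integrable_mult_indicator[OF _ u] by auto
  have scale: "\<bar>- s n\<bar> ^ DIM('a) * gauss_kernel (s n) (y - (y + (- s n) *\<^sub>R z)) = gauss_kernel 1 z"
    for n and z :: 'a
    using s_pos[of n] by (simp add: gauss_kernel_norm power_mult_distrib power_divide field_simps)
  have "(\<lambda>n. LBINT z. gauss_kernel 1 z *\<^sub>R near (y + (- s n) *\<^sub>R z))
        \<longlonglongrightarrow> (LBINT z. gauss_kernel 1 (z::'a) *\<^sub>R near y)"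
  proof (rule integral_dominated_convergence[where w="\<lambda>z. gauss_kernel 1 z * (norm (u y) + 1)"])
    show "integrable lborel (\<lambda>z::'a. gauss_kernel 1 z * (norm (u y) + 1))"
      using integrable_gauss_kernel(1)[of 1] by auto
    show "AE z in lborel. (\<lambda>n. gauss_kernel 1 z *\<^sub>R near (y + (- s n) *\<^sub>R z)) \<longlonglongrightarrow> gauss_kernel 1 z *\<^sub>R near y"
    proof (rule AE_I2)
      fix z :: 'a
      have "(\<lambda>n. y + (- s n) *\<^sub>R z) \<longlonglongrightarrow> y + (- 0) *\<^sub>R z" by (intro tendsto_intros s0)
      then have "(\<lambda>n. near (y + (- s n) *\<^sub>R z)) \<longlonglongrightarrow> near y"
        using isCont_tendsto_compose[OF near_cont] by simp
      then show "(\<lambda>n. gauss_kernel 1 z *\<^sub>R near (y + (- s n) *\<^sub>R z)) \<longlonglongrightarrow> gauss_kernel 1 z *\<^sub>R near y"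
        by (intro tendsto_intros)
    qed
    show "AE z in lborel. norm (gauss_kernel 1 z *\<^sub>R near (y + (- s n) *\<^sub>R z))
          \<le> gauss_kernel 1 z * (norm (u y) + 1)" for n
      using near_bound by (auto simp: gauss_kernel_norm intro!: mult_left_mono)
  qed measurable
  also have "(LBINT z. gauss_kernel 1 (z::'a) *\<^sub>R near y) = u y"
    using d(1) integrable_gauss_kernel[where 'a='a and s=1] by (simp add: near_def)
  also have "(\<lambda>n. LBINT z. gauss_kernel 1 z *\<^sub>R near (y + (- s n) *\<^sub>R z))
      = (\<lambda>n. LBINT x. gauss_kernel (s n) (y - x) *\<^sub>R near x)"
  proof
    fix n
    have "(LBINT x. gauss_kernel (s n) (y - x) *\<^sub>R near x)
        = (LBINT z. (\<bar>- s n\<bar> ^ DIM('a)) *\<^sub>R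
            (gauss_kernel (s n) (y - (y + (- s n) *\<^sub>R z)) *\<^sub>R near (y + (- s n) *\<^sub>R z)))"
      using s_pos[of n] by (intro integral_affine_reparam) auto
    then show "(LBINT z. gauss_kernel 1 z *\<^sub>R near (y + (- s n) *\<^sub>R z))
        = (LBINT x. gauss_kernel (s n) (y - x) *\<^sub>R near x)"
      by (simp only: scaleR_scaleR scale)
  qed
  finally have near_lim: "(\<lambda>n. LBINT x. gauss_kernel (s n) (y - x) *\<^sub>R near x) \<longlonglongrightarrow> u y" .
  \<comment> \<open>\<open>M n\<close> is the value of the kernel on the sphere of radius \<open>d\<close>, its supremum outside the ball.\<close>
  define M where "M n = (1 / (sqrt (2 * pi) * s n)) ^ DIM('a) * exp (- d\<^sup>2 / (2 * (s n)\<^sup>2))" for n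
  have M0: "M \<longlonglongrightarrow> 0"
  proof -
    have "((\<lambda>r::real. (1 / (sqrt (2 * pi) * r)) ^ DIM('a) * exp (- d\<^sup>2 / (2 * r\<^sup>2))) \<longlongrightarrow> 0) (at_right 0)"
      using d(1) by real_asymp
    moreover have "filterlim s (at_right 0) sequentially"
      using s0 s_pos by (auto simp: filterlim_at less_imp_neq[THEN not_sym] intro!: always_eventually)
    ultimately show ?thesis unfolding M_def[abs_def] by (rule filterlim_compose)
  qed
  have far_bound: "norm (LBINT x. gauss_kernel (s n) (y - x) *\<^sub>R far x) \<le> M n * (LBINT x. norm (far x))" for n
  proof -
    have pt: "norm (gauss_kernel (s n) (y - x) *\<^sub>R far x) \<le> M n * norm (far x)" for x
    proof (cases "x \<in> ball y d")
      case False
      then have "d\<^sup>2 \<le> (norm (y - x))\<^sup>2" using d(1) by (simp add: dist_norm)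
      then have "exp (- (norm (y - x))\<^sup>2 / (2 * (s n)\<^sup>2)) \<le> exp (- d\<^sup>2 / (2 * (s n)\<^sup>2))"
        using s_pos[of n] by (simp add: divide_right_mono)
      then show ?thesis using s_pos[of n]
        by (auto simp: gauss_kernel_norm M_def abs_mult intro!: mult_right_mono mult_left_mono)
    qed (simp add: far_def)
    have "norm (LBINT x. gauss_kernel (s n) (y - x) *\<^sub>R far x) \<le> (LBINT x. norm (gauss_kernel (s n) (y - x) *\<^sub>R far x))"
      by (rule integral_norm_bound)
    also have "\<dots> \<le> (LBINT x. M n * norm (far x))"
      using pt by (intro integral_mono integrable_norm integrable_mult_right ker far_int) auto
    finally show ?thesis by simp
  qed
  have far_lim: "(\<lambda>n. LBINT x. gauss_kernel (s n) (y - x) *\<^sub>R far x) \<longlonglongrightarrow> 0"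
    using far_bound by (intro Lim_null_comparison[OF always_eventually tendsto_mult_left_zero[OF M0]] allI)
  have "near x + far x = u x" for x by (auto simp: near_def far_def indicator_def)
  then have "(LBINT x. gauss_kernel (s n) (y - x) *\<^sub>R u x) = (LBINT x. gauss_kernel (s n) (y - x) *\<^sub>R near x)
      + (LBINT x. gauss_kernel (s n) (y - x) *\<^sub>R far x)" for n
    by (subst Bochner_Integration.integral_add[symmetric])
       (auto intro!: ker near_int far_int simp: scaleR_add_right[symmetric])
  then show ?thesis using tendsto_add[OF near_lim far_lim] by simp
qed

text \<open>Lebesgue measure is invariant under the sign change of one coordinate, so an integrand may be
  replaced by its even part in that coordinate.\<close>

lemma integral_average_reflection:
  fixes F G :: "'a::euclidean_space \<Rightarrow> 'b::{banach,second_countable_topology}"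
  assumes b: "b \<in> Basis" and F: "integrable lborel F"
    and avg: "\<And>x. F x + F (x - (2 * (x \<bullet> b)) *\<^sub>R b) = 2 *\<^sub>R G x"
  shows "integral\<^sup>L lborel F = integral\<^sup>L lborel G"
proof -
  let ?R = "\<lambda>x. x - (2 * (x \<bullet> b)) *\<^sub>R b"
  let ?c = "\<lambda>j. if j = b then - 1 else 1 :: real"
  have R: "(\<lambda>x. 0 + (\<Sum>j\<in>Basis. (?c j * (x \<bullet> j)) *\<^sub>R j)) = ?R"
    using b by (auto intro!: euclidean_eqI[where 'a='a] simp: inner_diff_left inner_Basis)
  have "lborel = density (distr lborel borel ?R) (\<lambda>_. ennreal (\<Prod>j\<in>Basis. \<bar>?c j\<bar>))"
    using lborel_affine_euclidean[of ?c 0] unfolding R by simp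
  also have "(\<Prod>j\<in>Basis. \<bar>?c j\<bar>) = 1" by (intro prod.neutral) auto
  finally have inv: "distr lborel borel ?R = lborel" by (simp add: density_1)
  have m: "?R \<in> lborel \<rightarrow>\<^sub>M borel" by measurable
  have "integrable (distr lborel borel ?R) F" using F by (simp add: inv)
  then have FR: "integrable lborel (\<lambda>x. F (?R x))"
    by (rule integrable_distr[OF m])
  have "integral\<^sup>L lborel F = (LBINT x. F (?R x))"
    using integral_distr[OF m, of F] F unfolding inv by auto
  then have "2 *\<^sub>R integral\<^sup>L lborel F = (LBINT x. F x + F (?R x))"
    using F FR by (simp add: scaleR_2)
  also have "\<dots> = 2 *\<^sub>R integral\<^sup>L lborel G" by (simp only: avg integral_scaleR_right)
  finally show ?thesis by simp
qed
section \<open>Octonion exponentials\<close>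

lemma omult_bounded_bilinear: "bounded_bilinear (\<cdot>)"
proof -
  have "bilinear (\<cdot>)"
    unfolding bilinear_def by (auto intro!: linearI simp: algebra_simps)
  then show ?thesis by (simp add: bilinear_conv_bounded_bilinear)
qed

interpretation omult: bounded_bilinear "(\<cdot>)" by (rule omult_bounded_bilinear)

text \<open>The octonions are a composition algebra: in coordinates this is the eight-square identity.\<close>

lemma norm_omult: "norm (v \<cdot> w) = norm v * norm w"
proof -
  have sq: "(norm ((c0,c1,c2,c3),(c4,c5,c6,c7)))\<^sup>2
    = c0 * c0 + c1 * c1 + c2 * c2 + c3 * c3 + c4 * c4 + c5 * c5 + c6 * c6 + c7 * c7"
    for c0 c1 c2 c3 c4 c5 c6 c7 :: real
    by (simp add: norm_prod_def power2_eq_square)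
  obtain a0 a1 a2 a3 a4 a5 a6 a7 where v: "v = ((a0,a1,a2,a3),(a4,a5,a6,a7))"
    by (metis prod.exhaust)
  obtain b0 b1 b2 b3 b4 b5 b6 b7 where w: "w = ((b0,b1,b2,b3),(b4,b5,b6,b7))"
    by (metis prod.exhaust)
  have "(norm (v \<cdot> w))\<^sup>2 = (norm v)\<^sup>2 * (norm w)\<^sup>2"
    unfolding v w by (simp add: sq, algebra)
  then show ?thesis by (simp add: power_mult_distrib[symmetric])
qed

lemma norm_oexp:
  assumes "1 \<le> k" "k \<le> 7"
  shows "norm (oexp k \<theta>) = 1"
proof -
  have "k \<in> {1,2,3,4,5,6,7}" using assms by auto
  then show ?thesis by (auto simp: oexp_def oe_def norm_prod_def zero_prod_def)
qed

lemma norm_omult_oexp [simp]: "1 \<le> k \<Longrightarrow> k \<le> 7 \<Longrightarrow> norm (v \<cdot> oexp k \<theta>) = norm v"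
  by (simp add: norm_omult norm_oexp)

lemma continuous_on_oexp:
  fixes g :: "'a::t2_space \<Rightarrow> real"
  shows "continuous_on A g \<Longrightarrow> continuous_on A (\<lambda>x. oexp k (g x))"
  unfolding oexp_def by (intro continuous_intros)

lemmas octonion_continuous_intros =
  continuous_intros omult.continuous_on continuous_on_oexp continuous_gauss_weight

text \<open>Right alternativity for an imaginary unit.\<close>

lemma omult_imaginary_unit_twice:
  assumes "1 \<le> k" "k \<le> 7"
  shows "v \<cdot> oe k \<cdot> oe k = - v"
proof -
  have "k \<in> {1,2,3,4,5,6,7}" using assms by auto
  then show ?thesis
    by (cases v; cases "fst v"; cases "snd v"; auto simp: oe_def zero_prod_def)
qed

lemma omult_oexp_add:
  assumes "1 \<le> k" "k \<le> 7"
  shows "v \<cdot> oexp k \<alpha> \<cdot> oexp k \<beta> = v \<cdot> oexp k (\<alpha> + \<beta>)"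
  by (simp add: oexp_def omult.add_left omult.add_right omult.diff_right omult.scaleR_left omult.scaleR_right
      oe_0_unit omult_imaginary_unit_twice[OF assms] sin_add cos_add algebra_simps)

lemma omult_oexp_average: "v \<cdot> oexp k \<theta> + v \<cdot> oexp k (- \<theta>) = (2 * cos \<theta>) *\<^sub>R v"
  by (simp add: oexp_def omult.add_right omult.diff_right omult.scaleR_right oe_0_unit omult.minus_right scaleR_2
      flip: scaleR_scaleR)

section \<open>The regularised inversion kernel\<close>

lemma prod_Basis_vec3:
  fixes g :: "real ^ 3 \<Rightarrow> real"
  shows "(\<Prod>b\<in>(Basis :: (real ^ 3) set). g b) = g (axis 1 1) * g (axis 2 1) * g (axis 3 1)"
proof -
  have eq: "(Basis :: (real ^ 3) set) = {axis 1 1, axis 2 1, axis 3 1}"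
    by (auto simp: Basis_vec_def UNIV_3)
  show ?thesis unfolding eq by (simp add: axis_eq_axis mult.assoc)
qed

text \<open>The product is nested so that, once the \<open>e4\<close> factors have been averaged to a scalar, the \<open>e2\<close>
  factors become adjacent, and after them the \<open>e1\<close> factors.  The order of the three reflections is
  forced by this nesting.\<close>

lemma integral_regularised_kernel:
  fixes x y :: "real ^ 3" and v :: octonion
  assumes "s > 0"
  shows "(LBINT f. gauss_weight s (f :: real ^ 3) *\<^sub>R
      (v \<cdot> oexp 1 (- (2 * pi * f $ 1 * x $ 1))
         \<cdot> oexp 2 (- (2 * pi * f $ 2 * x $ 2))
         \<cdot> oexp 4 (- (2 * pi * f $ 3 * x $ 3))
         \<cdot> oexp 4 (2 * pi * f $ 3 * y $ 3)
         \<cdot> oexp 2 (2 * pi * f $ 2 * y $ 2)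
         \<cdot> oexp 1 (2 * pi * f $ 1 * y $ 1))) = gauss_kernel s (y - x) *\<^sub>R v"
proof -
  \<comment> \<open>Phases of the analysis at \<open>x\<close>, of the synthesis at \<open>y\<close>, and their difference.\<close>
  define A :: "3 \<Rightarrow> real ^ 3 \<Rightarrow> real" where "A i f = 2 * pi * f $ i * x $ i" for i f
  define B :: "3 \<Rightarrow> real ^ 3 \<Rightarrow> real" where "B i f = 2 * pi * f $ i * y $ i" for i f
  define T :: "3 \<Rightarrow> real ^ 3 \<Rightarrow> real" where "T i f = 2 * pi * f $ i * (y - x) $ i" for i f
  let ?w = "gauss_weight s :: real ^ 3 \<Rightarrow> real"
  let ?R = "\<lambda>i f. f - (2 * (f \<bullet> axis i 1)) *\<^sub>R (axis i 1 :: real ^ 3)"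
  have BA: "B i f = A i f + T i f" for i f by (simp add: A_def B_def T_def algebra_simps)
  have axis: "axis i 1 \<in> (Basis :: (real ^ 3) set)" for i by simp
  have R: "?R i f $ j = (if j = i then - f $ j else f $ j)" for i j f
    by (simp add: inner_axis) (simp add: axis_def)
  have wR: "?w (?R i f) = ?w f" for i f
  proof -
    have "norm (?R i f) = norm f"
      unfolding norm_eq_sqrt_inner
      by (simp add: inner_diff_left inner_diff_right inner_axis_axis inner_commute[of "axis i 1"])
    then show ?thesis by (simp add: gauss_weight_def)
  qed
  have AR: "A j (?R i f) = (if j = i then - A j f else A j f)"
    and TR: "T j (?R i f) = (if j = i then - T j f else T j f)" for i j f
    unfolding A_def T_def R by auto
  have cont_AT: "continuous_on S (A i)" "continuous_on S (T i)" for i S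
    unfolding A_def[abs_def] T_def[abs_def] by (intro continuous_intros)+
  have w_int: "integrable lborel (\<lambda>f. ?w f * norm v)"
    using integrable_gauss_weight[OF assms, where 'a="real ^ 3"] by simp
  have int: "integrable lborel (\<lambda>f. ?w f *\<^sub>R F f)"
    if "continuous_on UNIV F" "\<And>f. norm (F f) \<le> norm v" for F :: "real ^ 3 \<Rightarrow> octonion"
  proof (rule Bochner_Integration.integrable_bound[OF w_int])
    show "(\<lambda>f. ?w f *\<^sub>R F f) \<in> borel_measurable lborel"
      using that(1) by (auto intro!: borel_measurable_continuous_onI octonion_continuous_intros)
    show "AE f in lborel. norm (?w f *\<^sub>R F f) \<le> norm (?w f * norm v)"
      using that(2) by (auto simp: abs_mult intro!: mult_left_mono)
  qed
  have "(LBINT f. ?w f *\<^sub>R (v \<cdot> oexp 1 (- A 1 f) \<cdot> oexp 2 (- A 2 f) \<cdot> oexp 4 (- A 3 f)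
         \<cdot> oexp 4 (B 3 f) \<cdot> oexp 2 (B 2 f) \<cdot> oexp 1 (B 1 f)))
    = (LBINT f. ?w f *\<^sub>R (v \<cdot> oexp 1 (- A 1 f) \<cdot> oexp 2 (- A 2 f) \<cdot> oexp 4 (T 3 f)
         \<cdot> oexp 2 (A 2 f + T 2 f) \<cdot> oexp 1 (A 1 f + T 1 f)))"
    by (simp add: omult_oexp_add BA)
  also have "\<dots> = (LBINT f. ?w f *\<^sub>R (cos (T 3 f) *\<^sub>R (v \<cdot> oexp 1 (- A 1 f) \<cdot> oexp 2 (T 2 f)
         \<cdot> oexp 1 (A 1 f + T 1 f))))"
  proof (rule integral_average_reflection[OF axis[of 3]], goal_cases)
    case 1
    show ?case by (rule int) (auto intro!: octonion_continuous_intros cont_AT)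
  next
    case (2 f)
    have "v \<cdot> oexp 1 (- A 1 f) \<cdot> oexp 2 (- A 2 f) \<cdot> oexp 4 (T 3 f) + v \<cdot> oexp 1 (- A 1 f) \<cdot> oexp 2 (- A 2 f) \<cdot> oexp 4 (- T 3 f)
      = (2 * cos (T 3 f)) *\<^sub>R (v \<cdot> oexp 1 (- A 1 f) \<cdot> oexp 2 (- A 2 f))"
      by (rule omult_oexp_average)
    then show ?case
      unfolding wR AR TR
      by (simp add: omult_oexp_add omult.scaleR_left flip: scaleR_add_right omult.add_left)
  qed
  also have "\<dots> = (LBINT f. ?w f *\<^sub>R (cos (T 3 f) *\<^sub>R (cos (T 2 f) *\<^sub>R (v \<cdot> oexp 1 (T 1 f)))))"
  proof (rule integral_average_reflection[OF axis[of 2]], goal_cases)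
    case 1
    show ?case by (rule int) (auto intro!: octonion_continuous_intros cont_AT mult_left_le_one_le)
  next
    case (2 f)
    have "v \<cdot> oexp 1 (- A 1 f) \<cdot> oexp 2 (T 2 f) + v \<cdot> oexp 1 (- A 1 f) \<cdot> oexp 2 (- T 2 f)
      = (2 * cos (T 2 f)) *\<^sub>R (v \<cdot> oexp 1 (- A 1 f))"
      by (rule omult_oexp_average)
    then show ?case
      unfolding wR AR TR
      by (simp add: omult_oexp_add omult.scaleR_left flip: scaleR_add_right omult.add_left)
  qed
  also have "\<dots> = (LBINT f. ?w f *\<^sub>R (cos (T 3 f) *\<^sub>R (cos (T 2 f) *\<^sub>R (cos (T 1 f) *\<^sub>R v))))"
  proof (rule integral_average_reflection[OF axis[of 1]], goal_cases)
    case 1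
    show ?case
      by (rule int) (auto intro!: octonion_continuous_intros cont_AT mult_left_le_one_le
        simp: abs_mult mult_le_one)
  next
    case (2 f)
    show ?case
      using omult_oexp_average[of v 1 "T 1 f"]
      unfolding wR AR TR
      by (simp flip: scaleR_add_right)
  qed
  also have "\<dots> = (LBINT f. (?w f * (\<Prod>b\<in>Basis. cos (2 * pi * (f \<bullet> b) * ((y - x) \<bullet> b)))) *\<^sub>R v)"
    unfolding prod_Basis_vec3 by (simp add: T_def inner_axis mult_ac)
  also have "\<dots> = gauss_kernel s (y - x) *\<^sub>R v"
    using integrable_gauss_weight_cos[OF assms, of "y - x"]
    by (simp only: integral_scaleR_left integral_gauss_weight_cos[OF assms])
  finally show ?thesis by (simp only: A_def B_def)
qed

section \<open>Inversion of the octonion Fourier transform\<close>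

definition oft_integrand :: "(real ^ 3 \<Rightarrow> octonion) \<Rightarrow> real ^ 3 \<Rightarrow> real ^ 3 \<Rightarrow> octonion" where
  "oft_integrand u f x = u x \<cdot> oexp 1 (- (2 * pi * f $ 1 * x $ 1))
         \<cdot> oexp 2 (- (2 * pi * f $ 2 * x $ 2))
         \<cdot> oexp 4 (- (2 * pi * f $ 3 * x $ 3))"

definition oft_synthesis :: "real ^ 3 \<Rightarrow> real ^ 3 \<Rightarrow> octonion \<Rightarrow> octonion" where
  "oft_synthesis y f q = q \<cdot> oexp 4 (2 * pi * f $ 3 * y $ 3)
         \<cdot> oexp 2 (2 * pi * f $ 2 * y $ 2)
         \<cdot> oexp 1 (2 * pi * f $ 1 * y $ 1)"

lemma continuous_on_oft_integrand:
  fixes g h :: "'a::t2_space \<Rightarrow> real ^ 3"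
  assumes "continuous_on UNIV u" "continuous_on S g" "continuous_on S h"
  shows "continuous_on S (\<lambda>z. oft_integrand u (g z) (h z))"
  unfolding oft_integrand_def
  by (intro octonion_continuous_intros continuous_on_compose2[OF assms(1) assms(3)] assms) auto

lemma borel_measurable_pair_continuous:
  assumes "continuous_on UNIV (g :: (real ^ 3) \<times> (real ^ 3) \<Rightarrow> octonion)"
  shows "g \<in> borel_measurable (lborel \<Otimes>\<^sub>M lborel)"
  using borel_measurable_continuous_onI[OF assms] by (simp add: borel_prod[symmetric] cong: measurable_cong_sets)

text \<open>The continuity of \<open>u\<close> makes all integrands Borel measurable, so the completion of Lebesgue
  measure can be dropped and Fubini's theorem is available.\<close>

lemma OFT_lborel:
  assumes "continuous_on UNIV u"
  shows "OFT u f = (LBINT x. oft_integrand u f x)" "OFT u \<in> borel_measurable borel"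
proof -
  have c: "continuous_on UNIV (oft_integrand u f)" for f
    by (intro continuous_on_oft_integrand assms continuous_intros)
  show eq: "OFT u f = (LBINT x. oft_integrand u f x)" for f
    unfolding OFT_def oft_integrand_def[symmetric]
    by (rule integral_completion) (use borel_measurable_continuous_onI[OF c] in simp)
  have "(\<lambda>f. LBINT x. oft_integrand u f x) \<in> borel_measurable lborel"
    by (rule lborel.borel_measurable_lebesgue_integral)
       (unfold split_beta', intro borel_measurable_pair_continuous continuous_on_oft_integrand
          assms continuous_intros)
  then show "OFT u \<in> borel_measurable borel" by (simp add: eq[abs_def])
qed

lemma OFT_regularised_inversion:
  assumes cont: "continuous_on UNIV u" and u: "integrable lborel u" and s: "s > 0"
  shows "(LBINT f. gauss_weight s f *\<^sub>R oft_synthesis y f (OFT u f))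
       = (LBINT x. gauss_kernel s (y - x) *\<^sub>R u x)"
proof -
  let ?H = "\<lambda>f x. gauss_weight s f *\<^sub>R oft_synthesis y f (oft_integrand u f x)"
  have nrm: "norm (?H f x) = gauss_weight s f * norm (u x)" for f x
    by (simp add: oft_synthesis_def oft_integrand_def gauss_weight_def)
  have meas: "case_prod ?H \<in> borel_measurable (lborel \<Otimes>\<^sub>M lborel)"
    unfolding split_beta' oft_synthesis_def
    by (intro borel_measurable_pair_continuous octonion_continuous_intros
        continuous_on_oft_integrand cont)
  have int: "integrable lborel (oft_integrand u f)" for f
  proof (rule Bochner_Integration.integrable_bound[OF integrable_norm[OF u]])
    have "continuous_on UNIV (oft_integrand u f)"
      by (intro continuous_on_oft_integrand cont continuous_intros)
    then show "oft_integrand u f \<in> borel_measurable lborel"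
      using borel_measurable_continuous_onI by simp
  qed (simp add: oft_integrand_def)
  have lin: "bounded_linear (\<lambda>q. gauss_weight s f *\<^sub>R oft_synthesis y f q)" for f
    unfolding oft_synthesis_def
    by (intro bounded_linear_compose[OF bounded_linear_scaleR_right]
        bounded_linear_compose[OF omult.bounded_linear_left] bounded_linear_ident)
  have pair: "integrable (lborel \<Otimes>\<^sub>M lborel) (case_prod ?H)"
  proof (rule lborel_pair.Fubini_integrable[OF meas])
    show "integrable lborel (\<lambda>f. LBINT x. norm (case_prod ?H (f, x)))"
      using integrable_gauss_weight[OF s, where 'a="real ^ 3"]
      by (simp only: prod.case nrm integral_mult_right_zero) (rule integrable_mult_left)
    show "AE f in lborel. integrable lborel (\<lambda>x. case_prod ?H (f, x))"
      using integrable_bounded_linear[OF lin int] by simp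
  qed
  have "(LBINT f. gauss_weight s f *\<^sub>R oft_synthesis y f (OFT u f)) = (LBINT f. LBINT x. ?H f x)"
    unfolding OFT_lborel(1)[OF cont]
    by (simp only: integral_bounded_linear[OF lin int])
  also have "\<dots> = (LBINT x. LBINT f. ?H f x)"
    by (rule lborel_pair.Fubini_integral[OF pair, symmetric])
  also have "\<dots> = (LBINT x. gauss_kernel s (y - x) *\<^sub>R u x)"
    unfolding oft_synthesis_def oft_integrand_def integral_regularised_kernel[OF s] ..
  finally show ?thesis .
qed

theorem OFT_inversion:
  assumes cont: "continuous_on UNIV u" and u: "integrable lborel u"
    and U: "integrable lborel (OFT u)"
  shows "u y = (LBINT f. oft_synthesis y f (OFT u f))"
proof -
  define s :: "nat \<Rightarrow> real" where "s n = 1 / Suc n" for n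
  have s0: "s \<longlonglongrightarrow> 0" and s_pos: "s n > 0" for n
    unfolding s_def[abs_def] by (real_asymp, simp)
  have syn: "(\<lambda>f. oft_synthesis y f (OFT u f)) \<in> borel_measurable borel"
  proof -
    have "(\<lambda>p. oft_synthesis y (fst p) (snd p)) \<in> borel_measurable (borel \<Otimes>\<^sub>M borel)"
      unfolding oft_synthesis_def borel_prod
      by (intro borel_measurable_continuous_onI octonion_continuous_intros)
    from measurable_compose[OF measurable_Pair[OF measurable_ident_sets[OF refl] OFT_lborel(2)[OF cont]] this]
    show ?thesis by simp
  qed
  have [measurable]: "(gauss_weight r :: real ^ 3 \<Rightarrow> real) \<in> borel_measurable borel" for r
    by (intro borel_measurable_continuous_onI continuous_gauss_weight continuous_intros)
  note syn[measurable]
  have "(\<lambda>n. LBINT f. gauss_weight (s n) f *\<^sub>R oft_synthesis y f (OFT u f))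
        \<longlonglongrightarrow> (LBINT f. oft_synthesis y f (OFT u f))"
  proof (rule integral_dominated_convergence[where w="\<lambda>f. norm (OFT u f)"])
    show "integrable lborel (\<lambda>f. norm (OFT u f))" using U by (rule integrable_norm)
    show "AE f in lborel. (\<lambda>n. gauss_weight (s n) f *\<^sub>R oft_synthesis y f (OFT u f))
        \<longlonglongrightarrow> oft_synthesis y f (OFT u f)"
    proof (rule AE_I2)
      fix f :: "real ^ 3"
      have "(\<lambda>n. gauss_weight (s n) f) \<longlonglongrightarrow> exp (- (2 * pi * 0 * norm f)\<^sup>2 / 2)"
        unfolding gauss_weight_def by (intro tendsto_intros s0) auto
      then show "(\<lambda>n. gauss_weight (s n) f *\<^sub>R oft_synthesis y f (OFT u f)) \<longlonglongrightarrow> oft_synthesis y f (OFT u f)"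
        by (auto intro: tendsto_eq_intros)
    qed
    show "AE f in lborel. norm (gauss_weight (s n) f *\<^sub>R oft_synthesis y f (OFT u f)) \<le> norm (OFT u f)" for n
      by (auto simp: gauss_weight_def oft_synthesis_def intro!: mult_left_le_one_le)
  qed measurable
  moreover have "(\<lambda>n. LBINT f. gauss_weight (s n) f *\<^sub>R oft_synthesis y f (OFT u f)) \<longlonglongrightarrow> u y"
    unfolding OFT_regularised_inversion[OF cont u s_pos]
    using cont by (intro gauss_kernel_approximate_identity u s0 s_pos) (simp add: continuous_on_eq_continuous_at)
  ultimately show ?thesis by (rule LIMSEQ_unique[symmetric])
qed

section \<open>Transforms with values in the complex line of e4\<close>

text \<open>Half the sum of the terms for \<open>\<beta>\<close> and \<open>- \<beta>\<close> is \<open>cos \<beta>\<close> plus \<open>e4 sin \<beta>\<close> times \<open>e6\<close>, where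
  \<open>e4 e6 = e2\<close>; the factors \<open>1 \<plusminus> e5\<close> act in the same way on \<open>\<alpha>\<close> through \<open>e4 e5 = e1\<close>.  The bracketing
  is not a formality, because \<open>e4\<close>, \<open>e6\<close>, \<open>e5\<close> do not associate; the identity is verified in
  coordinates.\<close>

lemma e4_valued_synthesis:
  assumes "c \<in> C_e4"
  shows "c \<cdot> oexp 4 \<gamma> \<cdot> oexp 2 \<beta> \<cdot> oexp 1 \<alpha> =
     (1/4) *\<^sub>R (c \<cdot> oexp 4 \<alpha> \<cdot> oexp 4 \<beta> \<cdot> oexp 4 \<gamma> \<cdot> (oe 0 + oe 6)
               + c \<cdot> oexp 4 \<alpha> \<cdot> oexp 4 (- \<beta>) \<cdot> oexp 4 \<gamma> \<cdot> (oe 0 - oe 6)) \<cdot> (oe 0 + oe 5)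
    + (1/4) *\<^sub>R (c \<cdot> oexp 4 (- \<alpha>) \<cdot> oexp 4 \<beta> \<cdot> oexp 4 \<gamma> \<cdot> (oe 0 + oe 6)
               + c \<cdot> oexp 4 (- \<alpha>) \<cdot> oexp 4 (- \<beta>) \<cdot> oexp 4 \<gamma> \<cdot> (oe 0 - oe 6)) \<cdot> (oe 0 - oe 5)"
  using assms by (auto simp: C_e4_def oexp_def oe_def zero_prod_def algebra_simps)

theorem theorem5:
  fixes u u_hat :: "real ^ 3 \<Rightarrow> octonion" and x1 x2 x3 :: real
  assumes "continuous_on UNIV u"
    and "integrable lebesgue u"
    and "integrable lebesgue (OFT u)"
    and "\<And>f. OFT u f \<in> C_e4"
  defines "u_hat \<equiv> inverse_FT_e4 (OFT u)"
  shows "u (vector [x1, x2, x3]) =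
      (1/4) *\<^sub>R (u_hat (vector [x1, x2, x3]) \<cdot> (oe 0 + oe 6)
               + u_hat (vector [x1, - x2, x3]) \<cdot> (oe 0 - oe 6)) \<cdot> (oe 0 + oe 5)
    + (1/4) *\<^sub>R (u_hat (vector [- x1, x2, x3]) \<cdot> (oe 0 + oe 6)
               + u_hat (vector [- x1, - x2, x3]) \<cdot> (oe 0 - oe 6)) \<cdot> (oe 0 - oe 5)"
proof -
  note cont = assms(1)
  have u: "integrable lborel u" and U: "integrable lborel (OFT u)"
    using assms(2,3) borel_measurable_continuous_onI[OF cont] OFT_lborel(2)[OF cont]
    by (simp_all add: integrable_completion)
  define H where "H p f = OFT u f \<cdot> oexp 4 (2 * pi * f $ 1 * p $ 1)
         \<cdot> oexp 4 (2 * pi * f $ 2 * p $ 2) \<cdot> oexp 4 (2 * pi * f $ 3 * p $ 3)" for p f :: "real ^ 3"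
  have H_meas: "H p \<in> borel_measurable borel" for p
  proof -
    have "(\<lambda>z. snd z \<cdot> oexp 4 (2 * pi * fst z $ 1 * p $ 1) \<cdot> oexp 4 (2 * pi * fst z $ 2 * p $ 2)
        \<cdot> oexp 4 (2 * pi * fst z $ 3 * p $ 3)) \<in> borel_measurable (borel \<Otimes>\<^sub>M borel)"
      unfolding borel_prod by (intro borel_measurable_continuous_onI octonion_continuous_intros)
    from measurable_compose[OF measurable_Pair[OF measurable_ident_sets[OF refl] OFT_lborel(2)[OF cont]] this]
    show ?thesis by (simp add: H_def[abs_def])
  qed
  have H_int: "integrable lborel (H p)" for p
    by (rule Bochner_Integration.integrable_bound[OF integrable_norm[OF U]])
       (use H_meas in \<open>simp_all add: H_def\<close>)
  have hat: "has_bochner_integral lborel (H p) (u_hat p)" for p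
    unfolding u_hat_def inverse_FT_e4_def H_def[symmetric]
    using H_int H_meas[of p] by (simp add: integral_completion has_bochner_integral_iff)
  let ?x = "vector [x1, x2, x3] :: real ^ 3"
  have "has_bochner_integral lborel
     (\<lambda>f. (1/4) *\<^sub>R (H (vector [x1, x2, x3]) f \<cdot> (oe 0 + oe 6)
               + H (vector [x1, - x2, x3]) f \<cdot> (oe 0 - oe 6)) \<cdot> (oe 0 + oe 5)
    + (1/4) *\<^sub>R (H (vector [- x1, x2, x3]) f \<cdot> (oe 0 + oe 6)
               + H (vector [- x1, - x2, x3]) f \<cdot> (oe 0 - oe 6)) \<cdot> (oe 0 - oe 5))
     ((1/4) *\<^sub>R (u_hat (vector [x1, x2, x3]) \<cdot> (oe 0 + oe 6)
               + u_hat (vector [x1, - x2, x3]) \<cdot> (oe 0 - oe 6)) \<cdot> (oe 0 + oe 5)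
    + (1/4) *\<^sub>R (u_hat (vector [- x1, x2, x3]) \<cdot> (oe 0 + oe 6)
               + u_hat (vector [- x1, - x2, x3]) \<cdot> (oe 0 - oe 6)) \<cdot> (oe 0 - oe 5))"
    by (intro has_bochner_integral_add has_bochner_integral_bounded_linear[OF omult.bounded_linear_left]
        has_bochner_integral_bounded_linear[OF bounded_linear_scaleR_right] hat)
  moreover have "(1/4) *\<^sub>R (H (vector [x1, x2, x3]) f \<cdot> (oe 0 + oe 6)
               + H (vector [x1, - x2, x3]) f \<cdot> (oe 0 - oe 6)) \<cdot> (oe 0 + oe 5)
    + (1/4) *\<^sub>R (H (vector [- x1, x2, x3]) f \<cdot> (oe 0 + oe 6)
               + H (vector [- x1, - x2, x3]) f \<cdot> (oe 0 - oe 6)) \<cdot> (oe 0 - oe 5)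
    = oft_synthesis ?x f (OFT u f)" for f
    using e4_valued_synthesis[OF assms(4)[of f], of "2 * pi * f $ 3 * x3" "2 * pi * f $ 2 * x2" "2 * pi * f $ 1 * x1"]
    by (simp add: H_def oft_synthesis_def vector_3)
  ultimately show ?thesis
    using OFT_inversion[OF cont u U, of ?x] by (simp add: has_bochner_integral_iff)
qed
end
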